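(* Let $G$ be a finite loopy multigraph whose degree sequence is graphical. Then $G$ can be transformed into a simple graph by a finite sequence of admissible double edge swaps.
   Context: A loopy multigraph is a finite undirected graph in which loops are allowed and in which there may be multiple edges between the same pair of vertices and multiple loops at the same vertex. The type of an edge joining $u$ and $v$ is the unordered pair $\{u,v\}$ (a loop at $v$ has type $\{v,v\}$), and the multiplicity of a type is the number of edges of that type. An edge is simple if it is not a loop and its type has multiplicity one; a graph is simple if all its edges are simple. The degree of a vertex is the number of half-edges attached to it (a loop contributes two), and the degree sequence is the list of degrees sorted in weakly decreasing order. A weakly decreasing sequence is graphical if it is the degree sequence of some simple graph. Given two distinct edges of types $\{v_1,v_2\}$ and $\{v_3,v_4\}$, the double edge swap $(v_1,v_2)(v_3,v_4)$ removes these two edges and adds an edge of type $\{v_2,v_3\}$ and an edge of type $\{v_4,v_1\}$. The swap is admissible if the two removed edges share no vertex and not both of them are simple (before the swap). *)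

theory Defs
  imports "HOL-Library.Multiset" "HOL-Library.Uprod"
begin

text \<open>
  Edges are represented by their types, i.e. unordered pairs, collected in a multiset; parallel
  edges and parallel loops are repeated elements. The loop type at \<open>v\<close> is \<open>Upair v v\<close>.
\<close>

record 'a multigraph =
  verts :: "'a set"
  edges :: "'a uprod multiset"

definition loopy_multigraph :: "'a multigraph \<Rightarrow> bool" where
  "loopy_multigraph G \<longleftrightarrow> finite (verts G) \<and> (\<forall>e\<in>#edges G. set_uprod e \<subseteq> verts G)"

abbreviation multiplicity :: "'a multigraph \<Rightarrow> 'a uprod \<Rightarrow> nat" where
  "multiplicity G e \<equiv> count (edges G) e"

definition is_loop :: "'a uprod \<Rightarrow> bool" where
  "is_loop e \<longleftrightarrow> (\<exists>v. e = Upair v v)"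

definition simple_edge :: "'a multigraph \<Rightarrow> 'a uprod \<Rightarrow> bool" where
  "simple_edge G e \<longleftrightarrow> \<not> is_loop e \<and> multiplicity G e = 1"

definition simple_graph :: "'a multigraph \<Rightarrow> bool" where
  "simple_graph G \<longleftrightarrow> loopy_multigraph G \<and> (\<forall>e\<in>#edges G. simple_edge G e)"

definition half_edges_at :: "'a \<Rightarrow> 'a uprod \<Rightarrow> nat" where
  "half_edges_at v e = (if e = Upair v v then 2 else if v \<in> set_uprod e then 1 else 0)"

definition degree :: "'a multigraph \<Rightarrow> 'a \<Rightarrow> nat" where
  "degree G v = (\<Sum>e\<in>#edges G. half_edges_at v e)"

definition degree_sequence :: "'a multigraph \<Rightarrow> nat list" where
  "degree_sequence G =
     rev (sorted_list_of_multiset (image_mset (degree G) (mset_set (verts G))))"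

text \<open>
  The witness has vertices in \<open>nat\<close>, which is no restriction, since every finite graph is
  isomorphic to one of these. Weak monotonicity of \<open>d\<close> is implied.
\<close>

definition graphical :: "nat list \<Rightarrow> bool" where
  "graphical d \<longleftrightarrow> (\<exists>H :: nat multigraph. simple_graph H \<and> degree_sequence H = d)"

definition double_edge_swap ::
    "'a \<Rightarrow> 'a \<Rightarrow> 'a \<Rightarrow> 'a \<Rightarrow> 'a multigraph \<Rightarrow> 'a multigraph" where
  "double_edge_swap v1 v2 v3 v4 G =
     G\<lparr>edges := edges G - {#Upair v1 v2, Upair v3 v4#} + {#Upair v2 v3, Upair v4 v1#}\<rparr>"

text \<open>
  The multiset inclusion says that \<open>G\<close> has two distinct edges of the given types.
\<close>

definition admissible ::
    "'a \<Rightarrow> 'a \<Rightarrow> 'a \<Rightarrow> 'a \<Rightarrow> 'a multigraph \<Rightarrow> bool" where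
  "admissible v1 v2 v3 v4 G \<longleftrightarrow>
     {#Upair v1 v2, Upair v3 v4#} \<subseteq># edges G \<and>
     set_uprod (Upair v1 v2) \<inter> set_uprod (Upair v3 v4) = {} \<and>
     \<not> (simple_edge G (Upair v1 v2) \<and> simple_edge G (Upair v3 v4))"

definition admissible_swap :: "'a multigraph \<Rightarrow> 'a multigraph \<Rightarrow> bool" where
  "admissible_swap G H \<longleftrightarrow>
     (\<exists>v1 v2 v3 v4. admissible v1 v2 v3 v4 G \<and> H = double_edge_swap v1 v2 v3 v4 G)"

end

theory Submission
  imports Defs
begin

text \<open>
  Fix a simple graph \<open>H\<close> with the same degrees as \<open>G\<close>, and call the edges of \<open>G - H\<close> red and those
  of \<open>H - G\<close> blue; at every vertex the red degree equals the blue degree. Given a red edge \<open>v1 v2\<close>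
  that is not simple, a blue edge \<open>v2 v3\<close> and a red edge \<open>v3 v4\<close> with \<open>v4 \<noteq> v1\<close>, the swap
  \<open>(v1,v2)(v3,v4)\<close> is admissible and decreases the number of red edges. If \<open>v1 = v2\<close>, then \<open>v4 \<noteq> v1\<close>
  is automatic. If \<open>v1 v2\<close> is a multiple edge and no such swap exists, then every blue neighbour of
  \<open>v2\<close> is a red neighbour of \<open>v1\<close>. As \<open>v1 v2\<close> is red too, the red degree of \<open>v1\<close> exceeds the blue degree
  of \<open>v2\<close>. By
  symmetry the red degree of \<open>v2\<close> exceeds the blue degree of \<open>v1\<close>, which is absurd.
\<close>

section \<open>Half-edges, degrees and their invariance under swaps\<close>

lemma Upair_commute: "Upair x y = Upair y x"
  by simp

lemma in_set_uprod_imp_Upair: "v \<in> set_uprod e \<Longrightarrow> \<exists>w. e = Upair v w"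
  by (cases e) auto

text \<open>Counting the two ends separately gives a loop its 2 with no case distinction.\<close>

lemma half_edges_at_Upair:
  "half_edges_at v (Upair x y) = of_bool (v = x) + of_bool (v = y)"
  by (auto simp: half_edges_at_def)

lemma half_edges_at_pos_iff: "half_edges_at v e > 0 \<longleftrightarrow> v \<in> set_uprod e"
  by (auto simp: half_edges_at_def)

lemma half_edges_at_map_uprod:
  assumes "inj_on f W" "set_uprod e \<subseteq> W" "w \<in> W"
  shows "half_edges_at (f w) (map_uprod f e) = half_edges_at w e"
  using assms by (cases e) (auto simp: half_edges_at_Upair inj_on_eq_iff)

lemma degree_outside:
  assumes "loopy_multigraph G" "v \<notin> verts G"
  shows "degree G v = 0"
  using assms by (auto simp: degree_def loopy_multigraph_def half_edges_at_def)

text \<open>The removed pair and the added pair have the same four ends \<open>v1\<close>,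
  \<open>v2\<close>, \<open>v3\<close>, \<open>v4\<close>.\<close>

lemma degree_double_edge_swap:
  assumes "{#Upair v1 v2, Upair v3 v4#} \<subseteq># edges G"
  shows "degree (double_edge_swap v1 v2 v3 v4 G) = degree G"
proof
  fix v
  obtain M where M: "edges G = {#Upair v1 v2, Upair v3 v4#} + M"
    using assms by (metis subset_mset.le_iff_add)
  show "degree (double_edge_swap v1 v2 v3 v4 G) v = degree G v"
    by (simp add: degree_def double_edge_swap_def M half_edges_at_Upair)
qed

lemma loopy_multigraph_double_edge_swap:
  assumes "loopy_multigraph G" "{#Upair v1 v2, Upair v3 v4#} \<subseteq># edges G"
  shows "loopy_multigraph (double_edge_swap v1 v2 v3 v4 G)"
proof -
  obtain M where M: "edges G = {#Upair v1 v2, Upair v3 v4#} + M"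
    using assms(2) by (metis subset_mset.le_iff_add)
  show ?thesis
    using assms(1) by (auto simp: loopy_multigraph_def double_edge_swap_def M)
qed

section \<open>Transporting a simple realisation to the vertices of the given graph\<close>

text \<open>Equality of the image multisets lets \<open>A\<close> and \<open>B\<close> be enumerated
  so that the values agree position by position; matching positions gives the bijection.\<close>

lemma image_mset_eq_imp_bij_betw:
  assumes "finite A" "finite B"
    and "image_mset f (mset_set A) = image_mset g (mset_set B)"
  obtains h where "bij_betw h A B" "\<And>x. x \<in> A \<Longrightarrow> g (h x) = f x"
proof -
  have "rel_mset (\<lambda>x y. f x = g y) (mset_set A) (mset_set B)"
    using assms(3) by (simp flip: multiset.rel_eq add: multiset.rel_map)
  then obtain xs ys where xs: "mset xs = mset_set A" and ys: "mset ys = mset_set B"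
    and rel: "list_all2 (\<lambda>x y. f x = g y) xs ys"
    by (auto simp: rel_mset_def)
  have len: "length xs = length ys"
    using rel by (rule list_all2_lengthD)
  have setxs: "set xs = A" and setys: "set ys = B"
    using xs ys assms(1,2) by (metis finite_set_mset_mset_set set_mset_mset)+
  have "distinct xs" "distinct ys"
    using xs ys setxs setys by (metis distinct_count_atmost_1 count_mset_set assms(1,2) count_mset)+
  then have b1: "bij_betw ((!) xs) {..<length xs} A" and b2: "bij_betw ((!) ys) {..<length xs} B"
    using setxs setys len by (auto intro!: bij_betw_nth)
  define h where "h = (!) ys \<circ> inv_into {..<length xs} ((!) xs)"
  have "bij_betw h A B"
    unfolding h_def using bij_betw_inv_into[OF b1] b2 by (rule bij_betw_trans)
  moreover have "g (h x) = f x" if "x \<in> A" for x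
  proof -
    obtain i where i: "i < length xs" "x = xs ! i"
      using \<open>x \<in> A\<close> setxs by (metis in_set_conv_nth)
    then have "h x = ys ! i"
      using b1 by (auto simp: h_def bij_betw_def)
    then show ?thesis
      using rel i by (auto dest: list_all2_nthD)
  qed
  ultimately show ?thesis
    using that by blast
qed

lemma count_image_mset_inj_on_superset:
  assumes "inj_on f S" "set_mset M \<subseteq> S" "x \<in> S"
  shows "count (image_mset f M) (f x) = count M x"
  using assms(2) by (induction M) (use assms(1,3) in \<open>auto simp: inj_on_eq_iff\<close>)

lemma simple_graph_map:
  assumes "simple_graph H" "inj_on f (verts H)"
  shows "simple_graph \<lparr>verts = f ` verts H, edges = image_mset (map_uprod f) (edges H)\<rparr>"
proof -
  \<comment> \<open>\<open>f\<close> is injective only on the vertices, so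
    \<open>map_uprod f\<close> is injective only on pairs inside \<open>verts H\<close>; this is
    enough to preserve multiplicities.\<close>
  define S where "S = {e. set_uprod e \<subseteq> verts H}"
  have fin: "finite (verts H)" and sub: "set_mset (edges H) \<subseteq> S"
    and simple: "\<And>e. e \<in># edges H \<Longrightarrow> \<not> is_loop e \<and> count (edges H) e = 1"
    using assms(1)
    by (auto simp: simple_graph_def loopy_multigraph_def simple_edge_def S_def)
  have inj: "inj_on (map_uprod f) S"
  proof (rule inj_onI)
    fix e e' assume "e \<in> S" "e' \<in> S" "map_uprod f e = map_uprod f e'"
    then show "e = e'"
      using assms(2) by (cases e; cases e') (auto simp: S_def inj_on_eq_iff)
  qed
  have loop: "\<not> is_loop (map_uprod f e)" if "e \<in> S" "\<not> is_loop e" for e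
    using that assms(2) by (cases e) (auto simp: is_loop_def S_def inj_on_eq_iff)
  have "set_uprod (map_uprod f e) \<subseteq> f ` verts H" if "e \<in># edges H" for e
    using that sub by (auto simp: S_def uprod.set_map)
  moreover have "count (image_mset (map_uprod f) (edges H)) (map_uprod f e) = 1"
    if "e \<in># edges H" for e
    using count_image_mset_inj_on_superset[OF inj sub] that sub simple by auto
  ultimately show ?thesis
    using fin sub simple loop
    by (auto simp: simple_graph_def loopy_multigraph_def simple_edge_def subset_iff)
qed

text \<open>The witness of \<open>graphical\<close> lives on \<open>nat\<close>, whereas comparing
  edge multisets with \<open>G\<close> requires the same vertices. Matching vertices of equal degree
  and relabelling bridges this gap.\<close>

lemma graphical_imp_simple_graph_same_degrees:
  fixes G :: "'a multigraph"
  assumes "loopy_multigraph G" "graphical (degree_sequence G)"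
  obtains H :: "'a multigraph" where "simple_graph H" "degree H = degree G"
proof -
  obtain H :: "nat multigraph" where H: "simple_graph H"
    and seq: "degree_sequence H = degree_sequence G"
    using assms(2) by (auto simp: graphical_def)
  have lH: "loopy_multigraph H" and finH: "finite (verts H)" and finG: "finite (verts G)"
    using H assms(1) by (auto simp: simple_graph_def loopy_multigraph_def)
  have "image_mset (degree H) (mset_set (verts H)) = image_mset (degree G) (mset_set (verts G))"
    using seq unfolding degree_sequence_def by (metis rev_is_rev_conv mset_sorted_list_of_multiset)
  then obtain f where f: "bij_betw f (verts H) (verts G)"
    and deg: "\<And>w. w \<in> verts H \<Longrightarrow> degree G (f w) = degree H w"
    using image_mset_eq_imp_bij_betw finH finG by metis
  define K where "K = \<lparr>verts = f ` verts H, edges = image_mset (map_uprod f) (edges H)\<rparr>"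
  have inj: "inj_on f (verts H)" and im: "f ` verts H = verts G"
    using f by (auto simp: bij_betw_def)
  have K: "simple_graph K"
    unfolding K_def using H inj by (rule simple_graph_map)
  have "degree K (f w) = degree H w" if "w \<in> verts H" for w
    using lH that
    by (auto simp: degree_def K_def image_mset.compositionality comp_def loopy_multigraph_def
        half_edges_at_map_uprod[OF inj] intro!: arg_cong[of _ _ sum_mset] image_mset_cong)
  then have "degree K v = degree G v" if "v \<in> verts G" for v
    using that deg im by (metis imageE)
  \<comment> \<open>The degree functions must also agree off the vertex set, where both are
    0.\<close>
  moreover have "degree K v = degree G v" if "v \<notin> verts G" for v
    using that assms(1) K im
    by (simp add: degree_outside simple_graph_def K_def)
  ultimately have "degree K = degree G"
    by blast
  then show ?thesis
    using K that by blast
qed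

section \<open>Counting red and blue half-edges\<close>

text \<open>The edges common to both graphs contribute equally to the two degrees and
  cancel.\<close>

lemma sum_half_edges_diff_eq:
  assumes "degree G v = degree H v"
  shows "(\<Sum>e\<in>#edges G - edges H. half_edges_at v e) =
    (\<Sum>e\<in>#edges H - edges G. half_edges_at v e)"
proof -
  have "degree G v = (\<Sum>e\<in>#edges G - edges H. half_edges_at v e) +
      (\<Sum>e\<in>#edges G \<inter># edges H. half_edges_at v e)"
    unfolding degree_def
    by (metis diff_intersect_left_idem image_mset_union subset_mset.inf_le1
        subset_mset.diff_add sum_mset.union)
  moreover have "degree H v = (\<Sum>e\<in>#edges H - edges G. half_edges_at v e) +
      (\<Sum>e\<in>#edges G \<inter># edges H. half_edges_at v e)"
    unfolding degree_def
    by (metis diff_intersect_right_idem image_mset_union subset_mset.inf_le2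
        subset_mset.diff_add sum_mset.union)
  ultimately show ?thesis
    using assms by simp
qed

text \<open>The edges \<open>f x\<close> are distinct and each has a half-edge at \<open>v\<close>.
  Loops and repetitions in \<open>M\<close> only enlarge the sum, so the bound suits the red
  edges.\<close>

lemma card_le_sum_half_edges:
  assumes "inj_on f S" "\<And>x. x \<in> S \<Longrightarrow> f x \<in># M \<and> v \<in> set_uprod (f x)"
  shows "card S \<le> (\<Sum>e\<in>#M. half_edges_at v e)"
proof -
  have sub: "f ` S \<subseteq> set_mset M"
    using assms(2) by auto
  have fin: "finite (f ` S)"
    using sub by (rule finite_subset) simp
  have "card S = (\<Sum>e\<in>f ` S. 1)"
    using assms(1) by (simp add: card_image)
  also have "\<dots> \<le> (\<Sum>e\<in>f ` S. half_edges_at v e)"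
    using assms(2) half_edges_at_pos_iff by (intro sum_mono) (fastforce simp: Suc_le_eq)
  also have "\<dots> = (\<Sum>e\<in>#mset_set (f ` S). half_edges_at v e)"
    by (simp add: sum_unfold_sum_mset)
  also have "\<dots> \<le> (\<Sum>e\<in>#M. half_edges_at v e)"
  proof -
    have "mset_set (f ` S) \<subseteq># M"
      using sub fin by (metis mset_set_set_mset_msubset subset_imp_msubset_mset_set
          finite_set_mset subset_mset.order_trans)
    then obtain N where "M = mset_set (f ` S) + N"
      by (metis subset_mset.le_iff_add)
    then show ?thesis
      by simp
  qed
  finally show ?thesis .
qed

text \<open>Without loops and repetitions, an edge at \<open>v\<close> has exactly one half-edge
  there and is determined by its other end. The blue edges qualify, as they come from a simple
  graph.\<close>

lemma sum_half_edges_le_card: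
  assumes "\<And>e. count M e \<le> 1" "\<And>e. e \<in># M \<Longrightarrow> \<not> is_loop e"
  shows "(\<Sum>e\<in>#M. half_edges_at v e) \<le> card {x. Upair v x \<in># M}"
proof -
  have "M = mset_set (set_mset M)"
    using assms(1) by (intro multiset_eqI)
      (metis count_mset_set(1,3) finite_set_mset le_antisym not_in_iff One_nat_def Suc_leI neq0_conv)
  then have "(\<Sum>e\<in>#M. half_edges_at v e) = (\<Sum>e\<in>set_mset M. half_edges_at v e)"
    by (simp add: sum_unfold_sum_mset)
  also have "\<dots> = (\<Sum>e\<in>{e\<in>set_mset M. v \<in> set_uprod e}. half_edges_at v e)"
    by (intro sum.mono_neutral_right) (auto simp: half_edges_at_def)
  also have "\<dots> = (\<Sum>e\<in>{e\<in>set_mset M. v \<in> set_uprod e}. 1)"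
    using assms(2) by (intro sum.cong) (auto simp: half_edges_at_def is_loop_def)
  also have "\<dots> = card {e\<in>set_mset M. v \<in> set_uprod e}"
    by simp
  also have "{e\<in>set_mset M. v \<in> set_uprod e} = Upair v ` {x. Upair v x \<in># M}"
  proof (intro equalityI subsetI)
    fix e assume "e \<in> {e\<in>set_mset M. v \<in> set_uprod e}"
    then show "e \<in> Upair v ` {x. Upair v x \<in># M}"
      using in_set_uprod_imp_Upair by fastforce
  qed auto
  also have "card \<dots> = card {x. Upair v x \<in># M}"
    by (intro card_image) (auto simp: inj_on_def)
  finally show ?thesis
    by simp
qed

section \<open>Existence of a decreasing swap\<close>

text \<open>Two red edges disappear. The new \<open>Upair v2 v3\<close> fills a copy missing from
  \<open>G\<close>, so only \<open>Upair v4 v1\<close> can become red: a net loss of at least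
  one.\<close>

lemma size_diff_double_edge_swap:
  assumes "{#Upair v1 v2, Upair v3 v4#} \<subseteq># edges G - edges H"
    and "Upair v2 v3 \<in># edges H - edges G"
  shows "size (edges (double_edge_swap v1 v2 v3 v4 G) - edges H) < size (edges G - edges H)"
proof -
  obtain M where M: "edges G - edges H = {#Upair v1 v2, Upair v3 v4#} + M"
    using assms(1) by (metis subset_mset.le_iff_add)
  have "edges (double_edge_swap v1 v2 v3 v4 G) - edges H \<subseteq># M + {#Upair v4 v1#}"
  proof (rule mset_subset_eqI)
    fix e
    have "count (edges G) e - count (edges H) e = count ({#Upair v1 v2, Upair v3 v4#} + M) e"
      using M by (metis count_diff)
    \<comment> \<open>Strictness leaves room for the added copy before the truncated difference
      becomes positive.\<close>
    moreover have "e = Upair v2 v3 \<Longrightarrow> count (edges G) e < count (edges H) e"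
      using assms(2) by (auto simp: in_diff_count)
    ultimately show "count (edges (double_edge_swap v1 v2 v3 v4 G) - edges H) e
        \<le> count (M + {#Upair v4 v1#}) e"
      by (auto simp: double_edge_swap_def split: if_splits)
  qed
  then have "size (edges (double_edge_swap v1 v2 v3 v4 G) - edges H) \<le> size M + 1"
    by (metis size_mset_mono size_single size_union)
  then show ?thesis
    by (simp add: M)
qed

lemma ex_decreasing_swap:
  assumes G: "loopy_multigraph G" and H: "simple_graph H" and deg: "degree G = degree H"
    and nonsimple: "\<not> simple_graph G"
  obtains v1 v2 v3 v4 where "admissible v1 v2 v3 v4 G"
    and "size (edges (double_edge_swap v1 v2 v3 v4 G) - edges H) < size (edges G - edges H)"
proof -
  note decreasing = that
  define R where "R = edges G - edges H"
  define B where "B = edges H - edges G"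
  have sum_eq: "(\<Sum>e\<in>#R. half_edges_at v e) = (\<Sum>e\<in>#B. half_edges_at v e)" for v
    unfolding R_def B_def using deg by (intro sum_half_edges_diff_eq) simp
  have not_both: "\<not> (e \<in># R \<and> e \<in># B)" for e
    by (auto simp: R_def B_def in_diff_count)
  have H_loop: "\<not> is_loop e" if "e \<in># edges H" for e
    using H that by (auto simp: simple_graph_def simple_edge_def)
  have H_count: "count (edges H) e \<le> 1" for e
    using H by (cases "e \<in># edges H") (auto simp: simple_graph_def simple_edge_def not_in_iff)
  have B_loop: "\<not> is_loop e" if "e \<in># B" for e
    using that H_loop by (auto simp: B_def dest: in_diffD)
  have B_count: "count B e \<le> 1" for e
    using H_count[of e] by (simp add: B_def)
  have B_irrefl: "x \<noteq> y" if "Upair x y \<in># B" for x y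
    using B_loop[OF that] by (auto simp: is_loop_def)
  have mem_iff: "(\<exists>e. e \<in># M \<and> v \<in> set_uprod e) \<longleftrightarrow> (\<Sum>e\<in>#M. half_edges_at v e) \<noteq> 0"
    for M :: "'a uprod multiset" and v
    by (auto simp flip: half_edges_at_pos_iff)
  \<comment> \<open>Positive blue degree at \<open>v\<close> forces positive red degree
    there.\<close>
  have ex_red: "\<exists>w. Upair v w \<in># R" if "Upair v u \<in># B" for v u
    using that mem_iff[of R v] mem_iff[of B v] sum_eq[of v] in_set_uprod_imp_Upair
    by (metis Upair_inject set_uprod_simps insertI1)
  have swap: thesis
    if red: "Upair v1 v2 \<in># R" "Upair v3 v4 \<in># R" and blue: "Upair v2 v3 \<in># B"
      and bad: "\<not> simple_edge G (Upair v1 v2)" and ne: "v4 \<noteq> v1" for v1 v2 v3 v4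
  proof -
    \<comment> \<open>Either equality would give a red and a blue edge the same type.\<close>
    have "v3 \<noteq> v1" "v4 \<noteq> v2"
      using not_both red blue by (metis Upair_inject)+
    then have disj: "set_uprod (Upair v1 v2) \<inter> set_uprod (Upair v3 v4) = {}"
      using ne B_irrefl[OF blue] by auto
    \<comment> \<open>Disjoint types differ, so one copy of each suffices for the inclusion.\<close>
    then have sub: "{#Upair v1 v2, Upair v3 v4#} \<subseteq># R"
      using red by (auto simp: insert_subset_eq_iff in_diff_count)
    then have "{#Upair v1 v2, Upair v3 v4#} \<subseteq># edges G"
      unfolding R_def by (metis diff_subset_eq_self subset_mset.order_trans)
    then have "admissible v1 v2 v3 v4 G"
      using disj bad by (simp add: admissible_def)
    then show thesis
      using decreasing size_diff_double_edge_swap sub blue unfolding R_def B_def by metis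
  qed
  obtain e where e: "e \<in># edges G" "\<not> simple_edge G e"
    using G nonsimple by (auto simp: simple_graph_def)
  \<comment> \<open>\<open>H\<close> has no loops and no multiplicity above one, so \<open>G\<close>
    has a copy of \<open>e\<close> in excess.\<close>
  have e_red: "e \<in># R"
  proof (cases "is_loop e")
    case True
    then show ?thesis
      using H_loop e(1) unfolding R_def in_diff_count
      by (metis count_greater_zero_iff not_in_iff)
  next
    case False
    then have "count (edges G) e > 1"
      using e by (simp add: simple_edge_def) (metis One_nat_def Suc_lessI count_greater_zero_iff)
    then show ?thesis
      using H_count[of e] by (auto simp: R_def in_diff_count)
  qed
  obtain v1 v2 where v: "e = Upair v1 v2"
    by (cases e)
  show thesis
  proof (rule ccontr)
    assume "\<not> thesis"
    have stuck: "y = a"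
      if "e = Upair a b" "Upair b x \<in># B" "Upair x y \<in># R" for a b x y
      using \<open>\<not> thesis\<close> swap[of a b x y] that e e_red by auto
    have less: "card {x. Upair b x \<in># B} < card {x. Upair a x \<in># B}" if ab: "e = Upair a b" for a b
    proof -
      let ?B = "{x. Upair b x \<in># B}"
      have red: "Upair a x \<in># R" if x: "x \<in> ?B" for x
      proof -
        have "Upair x b \<in># B"
          using x by (simp add: Upair_commute)
        then obtain y where y: "Upair x y \<in># R"
          using ex_red by blast
        then have "y = a"
          using stuck[OF ab] x by blast
        then show ?thesis
          using y by (simp add: Upair_commute)
      qed
      \<comment> \<open>Strictness comes from \<open>b\<close>: it is a red neighbour of
        \<open>a\<close> through \<open>e\<close>, but not a blue neighbour of itself.\<close>
      have "b \<notin> ?B"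
        using B_irrefl by auto
      moreover have "finite ?B"
      proof -
        have "Upair b ` ?B \<subseteq> set_mset B"
          by auto
        then have "finite (Upair b ` ?B)"
          by (rule finite_subset) simp
        then show ?thesis
          by (rule finite_imageD) (auto simp: inj_on_def)
      qed
      ultimately have "card ?B < card (insert b ?B)"
        by simp
      also have "\<dots> \<le> (\<Sum>e\<in>#R. half_edges_at a e)"
        using red e_red ab
        by (intro card_le_sum_half_edges[where f = "Upair a"]) (auto simp: inj_on_def)
      also have "\<dots> \<le> card {x. Upair a x \<in># B}"
        unfolding sum_eq using B_count B_loop by (rule sum_half_edges_le_card)
      finally show ?thesis .
    qed
    \<comment> \<open>The two inequalities contradict each other. If \<open>e\<close> is a loop,
      they coincide and each is already absurd, so no case split is made.\<close>
    show False
      using less[of v1 v2] less[of v2 v1] v by simp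
  qed
qed

theorem theorem3p2:
  fixes G :: "'a multigraph"
  assumes "loopy_multigraph G"
    and "graphical (degree_sequence G)"
  shows "\<exists>H. admissible_swap\<^sup>*\<^sup>* G H \<and> simple_graph H"
proof -
  obtain H :: "'a multigraph" where H: "simple_graph H" and "degree H = degree G"
    using graphical_imp_simple_graph_same_degrees[OF assms] .
  then have "degree G = degree H"
    by simp
  with assms(1) show ?thesis
  \<comment> \<open>\<open>H\<close> stays fixed while \<open>G\<close> varies: swaps preserve
    degrees, so \<open>H\<close> remains a valid target.\<close>
  proof (induction "size (edges G - edges H)" arbitrary: G rule: less_induct)
    case less
    show ?case
    proof (cases "simple_graph G")
      case False
      then obtain v1 v2 v3 v4 where adm: "admissible v1 v2 v3 v4 G"
        and dec: "size (edges (double_edge_swap v1 v2 v3 v4 G) - edges H) < size (edges G - edges H)"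
        using ex_decreasing_swap less.prems H by metis
      have "admissible_swap G (double_edge_swap v1 v2 v3 v4 G)"
        using adm by (auto simp: admissible_swap_def)
      moreover have "\<exists>K. admissible_swap\<^sup>*\<^sup>* (double_edge_swap v1 v2 v3 v4 G) K \<and> simple_graph K"
        using less.hyps[OF dec] less.prems adm
        by (simp add: admissible_def degree_double_edge_swap loopy_multigraph_double_edge_swap)
      ultimately show ?thesis
        by (meson converse_rtranclp_into_rtranclp)
    qed auto
  qed
qed

end
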